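(* Let $G,\Phi:\mathbb R^{m\times n}\to\overline{\mathbb R}$ be real orthogonal invariant. Suppose that $\Phi$ is convex and lsc. Further, let $\gamma>0$, $Y\in\mathbb R^{m\times n}$, and let $U\in O(m)$, $V\in O(n)$ be any real orthogonal matrices such that $Y=U\operatorname{Diag}(\sigma(Y))V^\top$. If $$x^\star\in\operatorname*{arg\,min}_{x\in\mathbb R^q}\; G(\operatorname{Diag}x)+(\gamma\star\Phi)(\operatorname{Diag}(x-\sigma(Y)))$$ with $q=\min(m,n)$, then $$U\operatorname{Diag}(x^\star)V^\top\in\operatorname*{arg\,min}_{X\in\mathbb R^{m\times n}}\; G(X)+(\gamma\star\Phi)(X-Y).$$
   Context: $\overline{\mathbb R}=\mathbb R\cup\{\pm\infty\}$. $O(n)$ is the group of real orthogonal $n\times n$ matrices. A function $F:\mathbb R^{m\times n}\to\overline{\mathbb R}$ is real orthogonal invariant if $F(UXV)=F(X)$ for all $X\in\mathbb R^{m\times n}$, $U\in O(m)$, $V\in O(n)$. $\sigma:\mathbb R^{m\times n}\to\mathbb R^{\min(m,n)}$ maps a matrix to its vector of singular values in nonincreasing order. $\operatorname{Diag}x$ is the (possibly rectangular, here $m\times n$) diagonal matrix with $x$ on its main diagonal. For $\gamma>0$, $(\gamma\star\Phi)(X)=\gamma\Phi(\gamma^{-1}X)$. *)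

theory Defs
  imports "HOL-Analysis.Analysis" "HOL-Computational_Algebra.Polynomial"
begin

text \<open>
  Real \<open>m \<times> n\<close> matrices are elements of \<open>real^'n^'m\<close>. The index types carry a linear order, so that
  ``the \<open>k\<close>-th row, column or coordinate'' makes sense: \<open>pos i\<close> is the 0-based position of the index
  \<open>i\<close>. The space of vectors of length \<open>min(m,n)\<close> is \<open>real^'q\<close> with \<open>CARD('q) = min CARD('m) CARD('n)\<close>,
  an equation that is assumed wherever it matters.
\<close>

definition pos :: "'a::{finite,linorder} \<Rightarrow> nat" where
  "pos i = card {..<i}"

text \<open>
  Since \<open>pos\<close> is injective, the sum has at most one term; it has exactly one if \<open>pos i = pos j\<close> and
  \<open>CARD('q) = min CARD('m) CARD('n)\<close>.
\<close>

definition Diag :: "real^('q::{finite,linorder}) \<Rightarrow> real^('n::{finite,linorder})^('m::{finite,linorder})" where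
  "Diag x = (\<chi> i j. \<Sum>k | pos k = pos i \<and> pos k = pos j. x $ k)"

definition charpoly :: "real^'n^'n \<Rightarrow> real poly" where
  "charpoly A = det (mat [:0, 1:] - (\<chi> i j. [:A $ i $ j:]))"

text \<open>
  The list of square roots of the eigenvalues of \<open>X\<^sup>T X\<close>, with multiplicity and in nonincreasing order,
  has length \<open>CARD('n)\<close>; the singular values are its first \<open>min CARD('m) CARD('n)\<close> entries. (If
  \<open>CARD('n) > CARD('m)\<close>, the remaining entries are zero.)
\<close>

definition sing_vals :: "real^('n::{finite,linorder})^('m::{finite,linorder}) \<Rightarrow> real^('q::{finite,linorder})" where
  "sing_vals X =
    (\<chi> k. rev (sorted_list_of_multiset (image_mset sqrt (proots (charpoly (transpose X ** X))))) ! pos k)"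

definition orthogonal_invariant :: "(real^'n^'m \<Rightarrow> ereal) \<Rightarrow> bool" where
  "orthogonal_invariant F \<longleftrightarrow>
    (\<forall>X U V. orthogonal_matrix U \<longrightarrow> orthogonal_matrix V \<longrightarrow> F (U ** X ** V) = F X)"

text \<open>
  Convexity of a function that may take both values \<open>\<infinity>\<close> and \<open>-\<infinity>\<close> is convexity of its epigraph, which is
  a set of pairs with a finite second component.
\<close>

definition ereal_convex :: "('a::real_vector \<Rightarrow> ereal) \<Rightarrow> bool" where
  "ereal_convex F \<longleftrightarrow> convex {(x, r :: real). F x \<le> ereal r}"

definition lsc :: "('a::topological_space \<Rightarrow> ereal) \<Rightarrow> bool" where
  "lsc F \<longleftrightarrow> (\<forall>x. F x \<le> Liminf (at x) F)"

definition epi_scale :: "real \<Rightarrow> ('a::real_vector \<Rightarrow> ereal) \<Rightarrow> 'a \<Rightarrow> ereal" (infixr "\<star>" 80) where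
  "(\<gamma> \<star> F) x = ereal \<gamma> * F (inverse \<gamma> *\<^sub>R x)"

text \<open>
  Objective functions below are sums of \<^typ>\<open>ereal\<close>-valued functions. Addition on \<^typ>\<open>ereal\<close> follows the
  usual convention for minimization, \<open>\<infinity> + (-\<infinity>) = (-\<infinity>) + \<infinity> = \<infinity>\<close>.
\<close>

definition argmin :: "('a \<Rightarrow> ereal) \<Rightarrow> 'a set" where
  "argmin F = {x. is_arg_min F (\<lambda>_. True) x}"

end

theory Submission
  imports Defs
begin

text \<open>
  Both terms of the objective are orthogonally invariant, so the matrices can be rotated until
  \<open>Y = Diag s\<close>, and then \<open>xstar\<close> gives a minimizer among the diagonal matrices. It remains to see that restricting
  to diagonal matrices loses nothing: for each \<open>X\<close> there is an \<open>x\<close> such that \<open>Diag x\<close> lies in the orbit of \<open>X\<close>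
  under two-sided orthogonal multiplication, which leaves \<open>G\<close> unchanged, and the \<open>\<Phi>\<close>-term at \<open>Diag (x - s)\<close> is
  at most the one at \<open>X - Diag s\<close>. This is \<open>diagonal_reduction\<close>; it holds for every vector \<open>s\<close>.

  The sublevel set \<open>C\<close> of the \<open>\<Phi>\<close>-term is closed, convex and invariant, so the question becomes
  geometric: if \<open>X - Diag s\<close> lies in \<open>C\<close>, then the orbit of \<open>X\<close> contains some \<open>Diag x\<close> with
  \<open>Diag (x - s)\<close> in \<open>C\<close> (\<open>diagonal_orbit_point\<close>). This is a form of the Lidskii--Mirsky inequality for singular values.
  The proof is variational. On the compact orbit of \<open>X\<close>, minimize
  half the squared distance of \<open>W - S\<close> to \<open>C\<close>, minus a small multiple \<open>e\<close> of \<open>W \<bullet> S\<close>, where \<open>S\<close> is a small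
  perturbation of \<open>Diag s\<close> whose diagonal entries have distinct nonzero absolute values. A minimizer \<open>W\<close>
  is diagonal (\<open>diagonal_orbit_point_near\<close>), for two reasons:

  \<^item> A maximizer \<open>W\<close> of the linear functional \<open>W \<bullet> H\<close> over an orbit makes \<open>W H\<^sup>T\<close> and \<open>W\<^sup>T H\<close> symmetric
    (\<open>symmetric_pair_if_max\<close>). Applied both to \<open>W\<close> and to the projection of \<open>Z = W - S\<close> onto \<open>C\<close>, this makes the
    pair of \<open>S\<close> and \<open>Y = (1 + e) Z - closest_point C Z\<close> symmetric, whence \<open>Y\<close> is diagonal.
  \<^item> The map that takes \<open>Z\<close> to \<open>Y\<close> is equivariant and, thanks to \<open>e > 0\<close>, injective. So \<open>Z\<close> shares the sign-flip
    symmetries of \<open>Y\<close>, which characterize diagonal matrices.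

  Letting \<open>e\<close> and the perturbation tend to zero brings \<open>W - Diag s\<close> into \<open>C\<close> in the limit.
\<close>

section \<open>Pairs of matrices with symmetric products\<close>

definition row_symmetric :: "real^'n^'m \<Rightarrow> real^'n^'m \<Rightarrow> bool" where
  "row_symmetric A B \<longleftrightarrow> (\<forall>i j. A $ i \<bullet> B $ j = A $ j \<bullet> B $ i)"

text \<open>
  The condition says that \<open>A B\<^sup>T\<close> and \<open>A\<^sup>T B\<close> are symmetric, which for square symmetric matrices is
  commutation. It is the rectangular stand-in for ``\<open>A\<close> and \<open>B\<close> have a common singular value
  decomposition, up to signs and order'', and unlike the latter it is visibly linear in each argument. This linearity is what
  the proof uses.
\<close>

definition symmetric_pair :: "real^'n^'m \<Rightarrow> real^'n^'m \<Rightarrow> bool" where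
  "symmetric_pair A B \<longleftrightarrow> row_symmetric A B \<and> row_symmetric (transpose A) (transpose B)"

lemma symmetric_pair_refl: "symmetric_pair A A"
  by (simp add: symmetric_pair_def row_symmetric_def inner_commute)

lemma symmetric_pair_sym: "symmetric_pair A B \<Longrightarrow> symmetric_pair B A"
  unfolding symmetric_pair_def row_symmetric_def by (metis inner_commute)

lemma transpose_diff: "transpose (A - B) = transpose A - transpose (B :: real^'n^'m)"
  by (simp add: transpose_def vec_eq_iff)

lemma symmetric_pair_diff:
  "symmetric_pair A B \<Longrightarrow> symmetric_pair A C \<Longrightarrow> symmetric_pair A (B - C)"
  by (simp add: symmetric_pair_def row_symmetric_def transpose_diff inner_diff_right)

lemma symmetric_pair_scaleR: "symmetric_pair A B \<Longrightarrow> symmetric_pair A (c *\<^sub>R B)"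
  by (simp add: symmetric_pair_def row_symmetric_def transpose_scalar)

lemma inner_transpose: "transpose A \<bullet> transpose B = A \<bullet> (B :: real^'n^'m)"
  by (simp add: inner_vec_def transpose_def) (rule sum.swap)

lemma inner_matrix_mul_left: "(P ** X) \<bullet> H = X \<bullet> (transpose P ** (H :: real^'n^'m))"
  for P :: "real^'k^'m"
proof -
  have "(P ** X) \<bullet> H = (\<Sum>i\<in>UNIV. \<Sum>j\<in>UNIV. \<Sum>k\<in>UNIV. P$i$k * X$k$j * H$i$j)"
    by (simp add: inner_vec_def matrix_matrix_mult_def sum_distrib_right)
  also have "\<dots> = (\<Sum>i\<in>UNIV. \<Sum>k\<in>UNIV. \<Sum>j\<in>UNIV. P$i$k * X$k$j * H$i$j)"
    by (rule sum.cong[OF refl]) (rule sum.swap)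
  also have "\<dots> = (\<Sum>k\<in>UNIV. \<Sum>i\<in>UNIV. \<Sum>j\<in>UNIV. P$i$k * X$k$j * H$i$j)"
    by (rule sum.swap)
  also have "\<dots> = (\<Sum>k\<in>UNIV. \<Sum>j\<in>UNIV. \<Sum>i\<in>UNIV. P$i$k * X$k$j * H$i$j)"
    by (rule sum.cong[OF refl]) (rule sum.swap)
  also have "\<dots> = X \<bullet> (transpose P ** H)"
    by (simp add: inner_vec_def matrix_matrix_mult_def transpose_def sum_distrib_left mult_ac)
  finally show ?thesis .
qed

lemma inner_matrix_mul_right: "(X ** Q) \<bullet> H = X \<bullet> ((H :: real^'n^'m) ** transpose Q)"
  for Q :: "real^'n^'k"
  using inner_matrix_mul_left[of "transpose Q" "transpose X" "transpose H"]
  by (metis inner_transpose matrix_transpose_mul transpose_transpose)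

lemma orthogonal_matrix_cancel:
  assumes "orthogonal_matrix P"
  shows "transpose P ** (P ** X) = X" "P ** (transpose P ** X) = X"
    "Y ** P ** transpose P = Y" "Y ** transpose P ** P = Y"
proof -
  show "transpose P ** (P ** X) = X" "P ** (transpose P ** X) = X"
    using assms by (simp_all add: orthogonal_matrix_def matrix_mul_assoc)
  show "Y ** P ** transpose P = Y" "Y ** transpose P ** P = Y"
    using assms by (simp_all add: orthogonal_matrix_def flip: matrix_mul_assoc)
qed

lemma inner_orthogonal_mul:
  fixes X H :: "real^'n^'m"
  assumes "orthogonal_matrix P" "orthogonal_matrix Q"
  shows "(P ** X ** Q) \<bullet> (P ** H ** Q) = X \<bullet> H"
proof -
  have "(P ** X ** Q) \<bullet> (P ** H ** Q) = (P ** X) \<bullet> (P ** H)"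
    using inner_matrix_mul_right[of "P ** X" Q "P ** H ** Q"] assms(2)
    by (simp add: orthogonal_matrix_cancel)
  also have "\<dots> = X \<bullet> H"
    using inner_matrix_mul_left[of P X "P ** H"] assms(1) by (simp add: orthogonal_matrix_cancel)
  finally show ?thesis .
qed

lemma norm_orthogonal_mul:
  fixes X :: "real^'n^'m"
  assumes "orthogonal_matrix P" "orthogonal_matrix Q"
  shows "norm (P ** X ** Q) = norm X"
  using inner_orthogonal_mul[OF assms] by (simp add: norm_eq_sqrt_inner)

lemma matrix_mul_diff:
  "P ** (A - B) ** Q = P ** A ** Q - P ** B ** (Q :: real^'n^'k)" for A B :: "real^'k^'m" and P :: "real^'m^'l"
  by (simp add: matrix_matrix_mult_def vec_eq_iff algebra_simps sum_subtractf sum_distrib_left sum_distrib_right)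

lemma matrix_mul_scaleR:
  "P ** (c *\<^sub>R A) ** Q = c *\<^sub>R (P ** A ** (Q :: real^'n^'k))" for A :: "real^'k^'m" and P :: "real^'m^'l"
  by (simp add: matrix_matrix_mult_def vec_eq_iff sum_distrib_left sum_distrib_right mult_ac)

section \<open>Maximizers over an orbit\<close>

definition plane_rotation :: "'m \<Rightarrow> 'm \<Rightarrow> real \<Rightarrow> real^'m^'m" where
  "plane_rotation i j t = (\<chi> k.
     if k = i then cos t *\<^sub>R axis i 1 - sin t *\<^sub>R axis j 1
     else if k = j then sin t *\<^sub>R axis i 1 + cos t *\<^sub>R axis j 1
     else axis k 1)"

lemma orthogonal_plane_rotation:
  assumes "i \<noteq> j"
  shows "orthogonal_matrix (plane_rotation i j t)"
proof -
  have *: "(plane_rotation i j t) $ k \<bullet> (plane_rotation i j t) $ l = (if k = l then 1 else 0)" for k l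
    using assms sin_cos_squared_add[of t]
    by (auto simp: plane_rotation_def inner_axis_axis inner_simps power2_eq_square)
  have "plane_rotation i j t ** transpose (plane_rotation i j t) = mat 1"
    using * by (simp add: vec_eq_iff matrix_matrix_mult_def transpose_def mat_def inner_vec_def)
  then show ?thesis
    by (metis orthogonal_matrix orthogonal_matrix_transpose transpose_transpose)
qed

lemma plane_rotation_mul:
  assumes "i \<noteq> j"
  shows "(plane_rotation i j t ** X) $ k =
    (if k = i then cos t *\<^sub>R X $ i - sin t *\<^sub>R X $ j
     else if k = j then sin t *\<^sub>R X $ i + cos t *\<^sub>R X $ j else X $ k)"
proof -
  have "(\<Sum>l\<in>UNIV. axis a (1::real) $ l * X $ l $ b) = X $ a $ b" for a b
    by (simp add: axis_def if_distrib[of "\<lambda>x. x * _"] cong: if_cong)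
  then show ?thesis
    using assms
    by (auto simp: plane_rotation_def vec_eq_iff matrix_matrix_mult_def algebra_simps sum.distrib
         sum_subtractf simp flip: sum_distrib_left)
qed

text \<open>
  First-order optimality for a linear functional along one-parameter rotation groups. Rotating in the
  plane of the coordinates \<open>i\<close> and \<open>j\<close> by the angle \<open>t\<close> turns the functional into
  \<open>r + a cos t + b sin t\<close>, and \<open>b\<close> is the \<open>(i,j)\<close> entry of \<open>X H\<^sup>T\<close> minus the \<open>(j,i)\<close> entry. A maximum at
  \<open>t = 0\<close> forces \<open>b = 0\<close>.
\<close>

lemma row_symmetric_if_max:
  fixes X H :: "real^'n^'m"
  assumes max: "\<And>P. orthogonal_matrix P \<Longrightarrow> (P ** X) \<bullet> H \<le> X \<bullet> H"
  shows "row_symmetric X H"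
  unfolding row_symmetric_def
proof (intro allI)
  fix i j
  show "X $ i \<bullet> H $ j = X $ j \<bullet> H $ i"
  proof (cases "i = j")
    case False
    let ?f = "\<lambda>t. (plane_rotation i j t ** X) \<bullet> H"
    define a where "a = X $ i \<bullet> H $ i + X $ j \<bullet> H $ j"
    define b where "b = X $ i \<bullet> H $ j - X $ j \<bullet> H $ i"
    define r where "r = (\<Sum>k\<in>UNIV - {i,j}. X $ k \<bullet> H $ k)"
    have split: "(\<Sum>k\<in>UNIV. g k) = g i + g j + sum g (UNIV - {i,j})" for g :: "'m \<Rightarrow> real"
    proof -
      have "sum g UNIV = sum g {i,j} + sum g (UNIV - {i,j})"
        by (metis finite finite_UNIV add.commute subset_UNIV sum.subset_diff)
      then show ?thesis using False by simp
    qed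
    have f: "?f t = r + a * cos t + b * sin t" for t
    proof -
      have "(\<Sum>k\<in>UNIV - {i,j}. (plane_rotation i j t ** X) $ k \<bullet> H $ k) = r"
        unfolding r_def by (rule sum.cong) (auto simp: plane_rotation_mul[OF False])
      then show ?thesis
        unfolding inner_vec_def[of "_ ** X"] split
        using False by (simp add: plane_rotation_mul[OF False] a_def b_def inner_simps algebra_simps)
    qed
    have 0: "?f 0 = X \<bullet> H"
      unfolding f inner_vec_def[of X] split by (simp add: a_def r_def)
    have "((\<lambda>t. r + a * cos t + b * sin t) has_real_derivative b) (at 0)"
      by (auto intro!: derivative_eq_intros)
    moreover have "\<forall>t. \<bar>0 - t\<bar> < 1 \<longrightarrow> r + a * cos t + b * sin t \<le> r + a * cos 0 + b * sin 0"
      using max[OF orthogonal_plane_rotation[OF False]] 0 by (simp add: f)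
    ultimately have "b = 0"
      using DERIV_local_max[of "\<lambda>t. r + a * cos t + b * sin t" b 0 1] by simp
    then show ?thesis by (simp add: b_def)
  qed simp
qed

lemma symmetric_pair_if_max:
  fixes X H :: "real^'n^'m"
  assumes max: "\<And>P Q. orthogonal_matrix P \<Longrightarrow> orthogonal_matrix Q \<Longrightarrow> (P ** X ** Q) \<bullet> H \<le> X \<bullet> H"
  shows "symmetric_pair X H"
proof -
  have "row_symmetric X H"
  proof (rule row_symmetric_if_max)
    fix P :: "real^'m^'m" assume "orthogonal_matrix P"
    then show "(P ** X) \<bullet> H \<le> X \<bullet> H" using max[of P "mat 1"] by (simp add: orthogonal_matrix_id)
  qed
  moreover have "row_symmetric (transpose X) (transpose H)"
  proof (rule row_symmetric_if_max)
    fix Q :: "real^'n^'n" assume "orthogonal_matrix Q"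
    then show "(Q ** transpose X) \<bullet> transpose H \<le> transpose X \<bullet> transpose H"
      using max[of "mat 1" "transpose Q"] 
      by (metis inner_transpose matrix_transpose_mul transpose_transpose matrix_mul_lid orthogonal_matrix_id orthogonal_matrix_transpose)
  qed
  ultimately show ?thesis by (simp add: symmetric_pair_def)
qed

section \<open>Orbits of the orthogonal groups\<close>

definition orbit :: "real^'n^'m \<Rightarrow> (real^'n^'m) set" where
  "orbit X = {P ** X ** Q | P Q. orthogonal_matrix P \<and> orthogonal_matrix Q}"

lemma orbitI: "orthogonal_matrix P \<Longrightarrow> orthogonal_matrix Q \<Longrightarrow> P ** X ** Q \<in> orbit X"
  by (auto simp: orbit_def)

lemma orbit_self: "X \<in> orbit X"
  using orbitI[OF orthogonal_matrix_id orthogonal_matrix_id, of X] by simp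

lemma orbit_mul:
  assumes "W \<in> orbit X" "orthogonal_matrix P" "orthogonal_matrix Q"
  shows "P ** W ** Q \<in> orbit X"
proof -
  obtain A B where W: "W = A ** X ** B" "orthogonal_matrix A" "orthogonal_matrix B"
    using assms by (auto simp: orbit_def)
  have "P ** W ** Q = (P ** A) ** X ** (B ** Q)" by (simp add: W matrix_mul_assoc)
  then show ?thesis using assms W by (auto intro!: orbitI orthogonal_matrix_mul)
qed

lemma norm_orbit: "W \<in> orbit X \<Longrightarrow> norm W = norm X"
  by (auto simp: orbit_def norm_orthogonal_mul)

lemma continuous_on_matrix_mul [continuous_intros]:
  fixes f :: "'a::topological_space \<Rightarrow> real^'k^'m" and g :: "'a \<Rightarrow> real^'n^'k"
  assumes "continuous_on S f" "continuous_on S g"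
  shows "continuous_on S (\<lambda>x. f x ** g x)"
  unfolding matrix_matrix_mult_def using assms by (intro continuous_intros)

lemma continuous_on_transpose [continuous_intros]:
  fixes f :: "'a::topological_space \<Rightarrow> real^'k^'m"
  assumes "continuous_on S f"
  shows "continuous_on S (\<lambda>x. transpose (f x))"
  unfolding transpose_def using assms by (intro continuous_intros)

text \<open>
  The defining equation makes the set closed, and by orthogonal invariance of the norm all its members
  have the norm of the identity matrix.
\<close>

lemma compact_orthogonal: "compact {P :: real^'n^'n. orthogonal_matrix P}"
proof -
  have "closed {P :: real^'n^'n. transpose P ** P = mat 1}"
    by (intro closed_Collect_eq continuous_intros)
  moreover have "norm P = norm (mat 1 :: real^'n^'n)" if "orthogonal_matrix P" for P :: "real^'n^'n"
    using norm_orthogonal_mul[OF that orthogonal_matrix_id, of "mat 1"] by simp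
  then have "bounded {P :: real^'n^'n. orthogonal_matrix P}"
    by (auto simp: bounded_iff)
  ultimately show ?thesis by (simp add: orthogonal_matrix compact_eq_bounded_closed)
qed

lemma compact_orbit: "compact (orbit X)"
proof -
  have "orbit X = (\<lambda>(P, Q). P ** X ** Q) ` ({P. orthogonal_matrix P} \<times> {Q. orthogonal_matrix Q})"
    by (auto simp: orbit_def)
  moreover have "compact \<dots>"
    by (intro compact_continuous_image compact_Times compact_orthogonal)
       (auto simp: case_prod_unfold intro!: continuous_intros)
  ultimately show ?thesis by simp
qed

section \<open>Projection onto a convex set that is a union of orbits\<close>

definition orbit_closed :: "(real^'n^'m) set \<Rightarrow> bool" where
  "orbit_closed C \<longleftrightarrow> (\<forall>Z\<in>C. orbit Z \<subseteq> C)"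

lemma orbit_closedD:
  "orbit_closed C \<Longrightarrow> Z \<in> C \<Longrightarrow> orthogonal_matrix P \<Longrightarrow> orthogonal_matrix Q \<Longrightarrow> P ** Z ** Q \<in> C"
  unfolding orbit_closed_def by (blast intro: orbitI)

text \<open>
  Orthogonal multiplications are isometries that map \<open>C\<close> onto itself, and the closest point is unique.
\<close>

lemma closest_point_equivariant:
  assumes C: "closed C" "convex C" "C \<noteq> {}" "orbit_closed C"
    and P: "orthogonal_matrix P" "orthogonal_matrix Q"
  shows "closest_point C (P ** Z ** Q) = P ** closest_point C Z ** Q"
proof (rule closest_point_unique[symmetric, OF C(2,1)])
  have p: "closest_point C Z \<in> C" by (rule closest_point_in_set[OF C(1,3)])
  show "P ** closest_point C Z ** Q \<in> C" using orbit_closedD[OF C(4) p P] .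
  show "\<forall>c\<in>C. dist (P ** Z ** Q) (P ** closest_point C Z ** Q) \<le> dist (P ** Z ** Q) c"
  proof
    fix c assume "c \<in> C"
    let ?c = "transpose P ** c ** transpose Q"
    have c: "?c \<in> C" using orbit_closedD[OF C(4) \<open>c \<in> C\<close>] P by simp
    have "P ** ?c ** Q = c" using P by (simp add: orthogonal_matrix_cancel flip: matrix_mul_assoc)
      (simp add: orthogonal_matrix_def)
    then have "dist (P ** Z ** Q) c = dist Z ?c"
      by (metis P dist_norm matrix_mul_diff norm_orthogonal_mul)
    moreover have "dist (P ** Z ** Q) (P ** closest_point C Z ** Q) = dist Z (closest_point C Z)"
      by (metis P dist_norm matrix_mul_diff norm_orthogonal_mul)
    ultimately show "dist (P ** Z ** Q) (P ** closest_point C Z ** Q) \<le> dist (P ** Z ** Q) c"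
      using closest_point_le[OF C(1) c] by simp
  qed
qed

text \<open>
  The closest point \<open>p\<close> maximizes the functional given by \<open>Z - p\<close> over \<open>C\<close>, in particular over its own
  orbit. So \<open>p\<close> forms a symmetric pair with \<open>Z - p\<close>, and hence with \<open>Z\<close>.
\<close>

lemma symmetric_pair_closest_point:
  fixes C :: "(real^'n^'m) set"
  assumes C: "closed C" "convex C" "C \<noteq> {}" "orbit_closed C"
  shows "symmetric_pair Z (closest_point C Z)"
proof -
  let ?p = "closest_point C Z"
  have "symmetric_pair ?p (Z - ?p)"
  proof (rule symmetric_pair_if_max)
    fix P :: "real^'m^'m" and Q :: "real^'n^'n"
    assume "orthogonal_matrix P" "orthogonal_matrix Q"
    then have "P ** ?p ** Q \<in> C"
      using orbit_closedD[OF C(4) closest_point_in_set[OF C(1,3)]] by blast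
    from closest_point_dot[OF C(2,1) this, of Z]
    show "(P ** ?p ** Q) \<bullet> (Z - ?p) \<le> ?p \<bullet> (Z - ?p)"
      by (simp add: inner_simps inner_commute)
  qed
  from symmetric_pair_diff[OF this symmetric_pair_scaleR[OF symmetric_pair_refl, of _ "-1"]]
  show ?thesis by (auto intro: symmetric_pair_sym)
qed

text \<open>
  The closest-point map is nonexpansive, whereas \<open>(1 + e) Z\<close> expands distances by \<open>1 + e > 1\<close>. Together
  with equivariance this shows that every symmetry of \<open>(1 + e) Z - closest_point C Z\<close> is a symmetry of \<open>Z\<close>.
  For \<open>e = 0\<close> injectivity is lost as soon as \<open>C\<close> has two points, since the residual is then zero on all of \<open>C\<close>.
\<close>

lemma relaxed_residual_inj:
  assumes C: "closed C" "convex C" "C \<noteq> {}" and e: "e > 0"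
    and eq: "(1 + e) *\<^sub>R Z - closest_point C Z = (1 + e) *\<^sub>R W - closest_point C W"
  shows "Z = W"
proof -
  have "(1 + e) *\<^sub>R (Z - W) = closest_point C Z - closest_point C W"
    using eq by (simp add: algebra_simps)
  then have "(1 + e) * norm (Z - W) \<le> norm (Z - W)"
    using closest_point_lipschitz[OF C(2,1,3), of Z W] e
    by (metis abs_of_nonneg add_nonneg_nonneg dist_norm less_imp_le norm_scaleR zero_le_one)
  then show ?thesis using e by (simp add: algebra_simps mult_le_0_iff)
qed

section \<open>Rectangular diagonal matrices\<close>

definition diagonal :: "real^('n::{finite,linorder})^('m::{finite,linorder}) \<Rightarrow> bool" where
  "diagonal X \<longleftrightarrow> (\<forall>i j. pos i \<noteq> pos j \<longrightarrow> X $ i $ j = 0)"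

lemma bij_pos: "bij_betw pos (UNIV :: 'a::{finite,linorder} set) {..<CARD('a)}"
proof -
  have "strict_mono (pos :: 'a \<Rightarrow> nat)"
    unfolding pos_def by (intro strict_monoI psubset_card_mono) auto
  then have inj: "inj (pos :: 'a \<Rightarrow> nat)" by (rule strict_mono_imp_inj_on)
  have "pos a < CARD('a)" for a :: 'a
    unfolding pos_def by (rule psubset_card_mono) auto
  then have "range (pos :: 'a \<Rightarrow> nat) \<subseteq> {..<CARD('a)}" by auto
  moreover have "card (range (pos :: 'a \<Rightarrow> nat)) = card {..<CARD('a)}"
    by (simp add: card_image[OF inj])
  ultimately have "range (pos :: 'a \<Rightarrow> nat) = {..<CARD('a)}"
    by (intro card_subset_eq) auto
  with inj show ?thesis by (simp add: bij_betw_def)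
qed

lemma pos_eq_iff [simp]: "pos i = pos j \<longleftrightarrow> i = (j :: 'a::{finite,linorder})"
  using bij_pos[where 'a='a] by (auto simp: bij_betw_def dest: injD)

lemma pos_less: "pos (i :: 'a::{finite,linorder}) < CARD('a)"
  using bij_pos[where 'a='a] by (auto simp: bij_betw_def)

lemma pos_surj: "p < CARD('a) \<Longrightarrow> \<exists>i :: 'a::{finite,linorder}. pos i = p"
proof -
  assume "p < CARD('a)"
  then have "p \<in> range (pos :: 'a \<Rightarrow> nat)"
    unfolding bij_betw_imp_surj_on[OF bij_pos[where 'a='a]] by simp
  then show ?thesis by blast
qed

lemma Diag_entry:
  fixes x :: "real^('q::{finite,linorder})"
  assumes "pos i = pos k" "pos j = pos k"
  shows "Diag x $ i $ j = x $ k"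
proof -
  have "{l. pos l = pos i \<and> pos l = pos j} = {k}" using assms by auto
  then show ?thesis by (simp add: Diag_def)
qed

lemma diagonal_Diag:
  "diagonal (Diag (x :: real^('q::{finite,linorder})) :: real^('n::{finite,linorder})^('m::{finite,linorder}))"
proof -
  have "Diag x $ i $ j = 0" if "pos i \<noteq> pos j" for i :: 'm and j :: 'n
  proof -
    have none: "{k::'q. pos k = pos i \<and> pos k = pos j} = {}"
      using that by fastforce
    show ?thesis by (simp only: Diag_def vec_lambda_beta none sum.empty)
  qed
  then show ?thesis by (simp add: diagonal_def)
qed

lemma diagonal_position:
  fixes i :: "'m::{finite,linorder}" and j :: "'n::{finite,linorder}"
  assumes q: "CARD('q::{finite,linorder}) = min CARD('m) CARD('n)" and "pos i = pos j"
  obtains k :: "'q::{finite,linorder}" where "pos i = pos k" "pos j = pos k"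
proof -
  have "pos i < CARD('q)" unfolding q using pos_less[of i] pos_less[of j] \<open>pos i = pos j\<close> by presburger
  from pos_surj[OF this] obtain k :: 'q where k: "pos k = pos i" ..
  show thesis by (rule that[OF k[symmetric] trans[OF \<open>pos i = pos j\<close>[symmetric] k[symmetric]]])
qed

lemma diagonal_eq_Diag:
  fixes X :: "real^('n::{finite,linorder})^('m::{finite,linorder})"
  assumes q: "CARD('q::{finite,linorder}) = min CARD('m) CARD('n)" and X: "diagonal X"
  obtains x :: "real^('q::{finite,linorder})" where "X = Diag x"
proof
  define r c where "r = (\<lambda>k::'q. SOME i::'m. pos i = pos k)" and "c = (\<lambda>k::'q. SOME j::'n. pos j = pos k)"
  have r: "pos (r k) = pos k" and c: "pos (c k) = pos k" for k
  proof -
    have m: "pos k < CARD('m)" and n: "pos k < CARD('n)" using pos_less[of k] unfolding q by linarith+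
    show "pos (r k) = pos k" unfolding r_def by (rule someI_ex[OF pos_surj[OF m]])
    show "pos (c k) = pos k" unfolding c_def by (rule someI_ex[OF pos_surj[OF n]])
  qed
  show "X = Diag (\<chi> k. X $ r k $ c k)"
  proof -
    have "X $ i $ j = Diag (\<chi> k. X $ r k $ c k) $ i $ j" for i j
    proof (cases "pos i = pos j")
      case True
      then obtain k :: 'q where k: "pos i = pos k" "pos j = pos k" by (rule diagonal_position[OF q])
      have "r k = i" "c k = j"
        using trans[OF r[of k] k(1)[symmetric]] trans[OF c[of k] k(2)[symmetric]] by (simp_all only: pos_eq_iff)
      then show ?thesis by (simp only: Diag_entry[OF k] vec_lambda_beta)
    next
      case False
      then show ?thesis using X[unfolded diagonal_def, rule_format, OF False]
          diagonal_Diag[of "\<chi> k. X $ r k $ c k", unfolded diagonal_def, rule_format, OF False]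
        by (simp only:)
    qed
    then show ?thesis unfolding vec_eq_iff by blast
  qed
qed

lemma Diag_add: "Diag (x + y) = Diag x + Diag y"
  by (simp add: Diag_def vec_eq_iff sum.distrib)

lemma Diag_scaleR: "Diag (c *\<^sub>R x) = c *\<^sub>R Diag x"
  by (simp add: Diag_def vec_eq_iff sum_distrib_left)

lemma Diag_diff: "Diag (x - y) = Diag x - Diag y"
  by (simp add: Diag_def vec_eq_iff sum_subtractf)

text \<open>
  Genericity means simple and nonzero singular values. It forces every matrix that forms a symmetric pair
  with \<open>S\<close> to be diagonal.
\<close>

definition generic_diagonal :: "real^('n::{finite,linorder})^('m::{finite,linorder}) \<Rightarrow> bool" where
  "generic_diagonal S \<longleftrightarrow> diagonal S \<and> (\<forall>i j. pos i = pos j \<longrightarrow> S $ i $ j \<noteq> 0) \<and>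
     (\<forall>i j k l. pos i = pos j \<longrightarrow> pos k = pos l \<longrightarrow> i \<noteq> k \<longrightarrow> (S $ i $ j)\<^sup>2 \<noteq> (S $ k $ l)\<^sup>2)"

lemma inner_diagonal_row:
  assumes "diagonal S" "pos k = pos l"
  shows "v \<bullet> S $ k = v $ l * S $ k $ l"
proof -
  have "v \<bullet> S $ k = (\<Sum>j\<in>UNIV. if j = l then v $ l * S $ k $ l else 0)"
    unfolding inner_vec_def using assms
    by (intro sum.cong) (auto simp: diagonal_def)
  then show ?thesis by simp
qed

lemma inner_diagonal_row_0:
  fixes v :: "real^('n::{finite,linorder})" and k :: "'m::{finite,linorder}"
  assumes "diagonal S" "\<nexists>l::'n. pos l = pos k"
  shows "v \<bullet> S $ k = 0"
proof -
  have "S $ k $ l = 0" for l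
    using assms(1)[unfolded diagonal_def, rule_format, of k l] assms(2) by metis
  then show ?thesis by (simp add: inner_vec_def)
qed

lemma diagonal_transpose: "diagonal S \<Longrightarrow> diagonal (transpose S)"
  by (auto simp: diagonal_def transpose_def)

text \<open>
  The rectangular version of: a matrix that commutes with a diagonal matrix with distinct eigenvalues is
  diagonal. If the position \<open>(i,j)\<close> has a mirror image \<open>(k,l)\<close> in the rectangle, the two symmetry
  conditions are linear equations for the two entries of \<open>X\<close>, with determinant the difference of
  the squares of two diagonal entries of \<open>S\<close>. If not, one of the conditions says directly that the entry
  times a nonzero entry of \<open>S\<close> is zero.
\<close>

lemma diagonal_if_symmetric_pair:
  fixes S X :: "real^('n::{finite,linorder})^('m::{finite,linorder})"
  assumes S: "generic_diagonal S" and pair: "symmetric_pair X S"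
  shows "diagonal X"
  unfolding diagonal_def
proof (intro allI impI)
  fix i :: 'm and j :: 'n
  assume ij: "pos i \<noteq> pos j"
  have D: "diagonal S" "diagonal (transpose S)"
    using S by (auto simp: generic_diagonal_def diagonal_transpose)
  have row: "X $ a \<bullet> S $ b = X $ b \<bullet> S $ a" 
    and col: "transpose X $ c \<bullet> transpose S $ d = transpose X $ d \<bullet> transpose S $ c" for a b c d
    using pair by (auto simp: symmetric_pair_def row_symmetric_def)
  have tr: "transpose X $ b $ a = X $ a $ b" "transpose S $ b $ a = S $ a $ b" for a b
    by (simp_all add: transpose_def)
  consider (no_row) "\<nexists>k::'m. pos k = pos j" | (no_col) "\<nexists>l::'n. pos l = pos i"
    | (both) k :: 'm and l :: 'n where "pos k = pos j" "pos l = pos i"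
    by blast
  then show "X $ i $ j = 0"
  proof cases
    case no_row
    have "\<not> pos j < CARD('m)"
    proof
      assume "pos j < CARD('m)"
      from pos_surj[OF this] no_row show False by blast
    qed
    then have "pos i < CARD('n)" using pos_less[of i] pos_less[of j] by linarith
    from pos_surj[OF this] obtain l :: 'n where l: "pos l = pos i" ..
    have "transpose X $ j \<bullet> transpose S $ l = 0"
      using col[of j l] inner_diagonal_row_0[OF D(2) no_row] by simp
    then have "X $ i $ j * S $ i $ l = 0"
      using inner_diagonal_row[OF D(2) l] by (simp add: tr)
    then show ?thesis using S l by (simp add: generic_diagonal_def)
  next
    case no_col
    have "\<not> pos i < CARD('n)"
    proof
      assume "pos i < CARD('n)"
      from pos_surj[OF this] no_col show False by blast
    qed
    then have "pos j < CARD('m)" using pos_less[of i] pos_less[of j] by linarith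
    from pos_surj[OF this] obtain k :: 'm where k: "pos k = pos j" ..
    have "X $ i \<bullet> S $ k = 0"
      using row[of i k] inner_diagonal_row_0[OF D(1) no_col] by simp
    then have "X $ i $ j * S $ k $ j = 0"
      using inner_diagonal_row[OF D(1) k] by simp
    then show ?thesis using S k by (simp add: generic_diagonal_def)
  next
    case both
    have 1: "X $ i $ j * S $ k $ j = X $ k $ l * S $ i $ l"
      using row[of i k] inner_diagonal_row[OF D(1) both(1)] inner_diagonal_row[OF D(1) both(2)[symmetric]] by simp
    have 2: "X $ k $ l * S $ k $ j = X $ i $ j * S $ i $ l"
      using col[of l j] inner_diagonal_row[OF D(2) both(1)[symmetric]] inner_diagonal_row[OF D(2) both(2)]
      by (simp add: tr)
    have "X $ i $ j * (S $ k $ j)\<^sup>2 = (X $ i $ j * S $ k $ j) * S $ k $ j"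
      by (simp only: power2_eq_square mult.assoc)
    also have "\<dots> = (X $ k $ l * S $ k $ j) * S $ i $ l" unfolding 1 by (simp only: mult_ac)
    also have "\<dots> = X $ i $ j * (S $ i $ l)\<^sup>2" unfolding 2 by (simp only: power2_eq_square mult.assoc)
    finally have eq: "X $ i $ j * (S $ k $ j)\<^sup>2 = X $ i $ j * (S $ i $ l)\<^sup>2" .
    have "k \<noteq> i" using ij both(1) by metis
    then have "(S $ k $ j)\<^sup>2 \<noteq> (S $ i $ l)\<^sup>2"
      using S both(1) both(2)[symmetric] unfolding generic_diagonal_def by blast
    then show ?thesis using eq by simp
  qed
qed

text \<open>
  Sign flips characterize diagonality by a symmetry, a form in which it passes through equivariant
  injective maps.
\<close>

definition sign_flip :: "nat \<Rightarrow> real^('a::{finite,linorder})^('a::{finite,linorder})" where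
  "sign_flip p = (\<chi> i j. if i = j then if pos i = p then -1 else 1 else 0)"

lemma sign_flip_mul:
  "(sign_flip p ** X) $ i $ j = (if pos i = p then -1 else 1) * X $ i $ j"
  "(Y ** sign_flip p) $ k $ l = Y $ k $ l * (if pos l = p then -1 else 1)"
proof -
  have "(sign_flip p ** X) $ i $ j = (\<Sum>k\<in>UNIV. if i = k then (if pos i = p then -1 else 1) * X $ k $ j else 0)"
    unfolding matrix_matrix_mult_def sign_flip_def vec_lambda_beta by (intro sum.cong) auto
  then show "(sign_flip p ** X) $ i $ j = (if pos i = p then -1 else 1) * X $ i $ j" by simp
  have "(Y ** sign_flip p) $ k $ l = (\<Sum>i\<in>UNIV. if i = l then Y $ k $ i * (if pos l = p then -1 else 1) else 0)"
    unfolding matrix_matrix_mult_def sign_flip_def vec_lambda_beta by (intro sum.cong) auto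
  then show "(Y ** sign_flip p) $ k $ l = Y $ k $ l * (if pos l = p then -1 else 1)" by simp
qed

lemma sign_flip_entry:
  "(sign_flip p ** X ** sign_flip p) $ i $ j =
    (if pos i = p then -1 else 1) * X $ i $ j * (if pos j = p then -1 else 1)"
  by (simp only: sign_flip_mul)

lemma orthogonal_sign_flip:
  "orthogonal_matrix (sign_flip p :: real^('a::{finite,linorder})^('a::{finite,linorder}))"
proof -
  let ?F = "sign_flip p :: real^('a::{finite,linorder})^('a::{finite,linorder})"
  have sym: "transpose ?F = ?F"
    by (auto simp: vec_eq_iff transpose_def sign_flip_def)
  have "(?F ** ?F) $ i $ j = mat 1 $ i $ j" for i j
    unfolding sign_flip_mul by (simp add: sign_flip_def mat_def)
  then show ?thesis unfolding orthogonal_matrix sym vec_eq_iff by blast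
qed

lemma diagonal_iff_sign_flip:
  fixes X :: "real^('n::{finite,linorder})^('m::{finite,linorder})"
  shows "diagonal X \<longleftrightarrow> (\<forall>p. sign_flip p ** X ** sign_flip p = X)"
proof
  assume "diagonal X"
  then show "\<forall>p. sign_flip p ** X ** sign_flip p = X"
    by (auto simp: vec_eq_iff sign_flip_entry diagonal_def)
next
  assume *: "\<forall>p. sign_flip p ** X ** sign_flip p = X"
  show "diagonal X"
    unfolding diagonal_def
  proof (intro allI impI)
    fix i :: 'm and j :: 'n assume "pos i \<noteq> pos j"
    then show "X $ i $ j = 0"
      using *[rule_format, of "pos i"] sign_flip_entry[of "pos i" X i j] by simp
  qed
qed

section \<open>Moving a matrix to a diagonal one inside its orbit\<close>

text \<open>
  Let \<open>W\<close> minimize \<open>f W = dist(W - S, C)\<^sup>2 / 2 - e (W \<bullet> S)\<close> over the compact orbit of \<open>X\<close>, and put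
  \<open>Z = W - S\<close> and \<open>p = closest_point C Z\<close>. Replacing the distance to \<open>C\<close> by the distance to the single point
  \<open>p\<close> gives a majorant of \<open>f\<close> that agrees with \<open>f\<close> at \<open>W\<close>, so \<open>W\<close> minimizes the majorant too. On the orbit,
  where the norm is constant, the majorant is a constant minus the linear functional given by
  \<open>(1 + e) S + p\<close>. Hence \<open>W\<close> forms a symmetric pair with \<open>(1 + e) S + p\<close>, and then with
  \<open>Y = (1 + e) W - ((1 + e) S + p) = (1 + e) Z - p\<close>. As \<open>Z\<close> forms a symmetric pair with \<open>p\<close>, it does so with \<open>Y\<close>.
  By linearity \<open>S = W - Z\<close> forms a symmetric pair with \<open>Y\<close>, so \<open>Y\<close> is diagonal. The sign-flip symmetries of \<open>Y\<close>
  are inherited by \<open>Z\<close>, so \<open>Z\<close> and \<open>W\<close> are diagonal. The bound follows from \<open>f W \<le> f X\<close> and the Cauchy--Schwarz inequality.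
\<close>

lemma diagonal_orbit_point_near:
  fixes C :: "(real^('n::{finite,linorder})^('m::{finite,linorder})) set"
  assumes C: "closed C" "convex C" "orbit_closed C" and c0: "c0 \<in> C"
    and S: "generic_diagonal S" and e: "e > 0"
  obtains W c where "W \<in> orbit X" "diagonal W" "c \<in> C"
    "(norm (W - S - c))\<^sup>2 \<le> (norm (X - S - c0))\<^sup>2 + 4 * e * norm X * norm S"
proof -
  have ne: "C \<noteq> {}" using c0 by blast
  let ?\<pi> = "closest_point C"
  define f where "f = (\<lambda>W. (norm (W - S - ?\<pi> (W - S)))\<^sup>2 / 2 - e * (W \<bullet> S))"
  have "continuous_on (orbit X) f"
    unfolding f_def
    by (intro continuous_intros continuous_on_compose2[OF continuous_on_closest_point[OF C(2,1) ne, of UNIV]]) auto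
  then obtain W where W: "W \<in> orbit X" and min: "\<And>V. V \<in> orbit X \<Longrightarrow> f W \<le> f V"
    using continuous_attains_inf[OF compact_orbit, of X f] orbit_self[of X] by blast
  define Z where "Z = W - S"
  define p where "p = ?\<pi> Z"
  have p: "p \<in> C" unfolding p_def by (rule closest_point_in_set[OF C(1) ne])
  have "symmetric_pair W ((1 + e) *\<^sub>R S + p)"
  proof (rule symmetric_pair_if_max)
    fix P :: "real^('m::{finite,linorder})^('m::{finite,linorder})" and Q :: "real^('n::{finite,linorder})^('n::{finite,linorder})"
    assume PQ: "orthogonal_matrix P" "orthogonal_matrix Q"
    define V where "V = P ** W ** Q"
    have V: "V \<in> orbit X" using orbit_mul[OF W PQ] by (simp add: V_def)
    \<comment> \<open>On the orbit the majorant is affine in \<open>A\<close>, because \<open>norm A = norm X\<close>.\<close>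
    have eqn: "(norm (A - S - p))\<^sup>2 / 2 - e * (A \<bullet> S)
        = (norm X)\<^sup>2 / 2 + (norm (S + p))\<^sup>2 / 2 - A \<bullet> ((1 + e) *\<^sub>R S + p)" if "A \<in> orbit X" for A
      unfolding norm_orbit[OF that, symmetric] power2_norm_eq_inner
      by (simp add: inner_simps inner_commute field_simps)
    have "f W \<le> f V" by (rule min[OF V])
    also have "\<dots> \<le> (norm (V - S - p))\<^sup>2 / 2 - e * (V \<bullet> S)"
      unfolding f_def using closest_point_le[OF C(1) p, of "V - S"]
      by (simp add: dist_norm power_mono)
    finally show "(P ** W ** Q) \<bullet> ((1 + e) *\<^sub>R S + p) \<le> W \<bullet> ((1 + e) *\<^sub>R S + p)"
      using eqn[OF W] eqn[OF V] by (simp add: f_def V_def p_def Z_def)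
  qed
  from symmetric_pair_diff[OF symmetric_pair_scaleR[OF symmetric_pair_refl, of _ "1 + e"] this]
  have WY0: "symmetric_pair W ((1 + e) *\<^sub>R W - ((1 + e) *\<^sub>R S + p))" .
  define Y where "Y = (1 + e) *\<^sub>R Z - p"
  have "(1 + e) *\<^sub>R W - ((1 + e) *\<^sub>R S + p) = Y"
    by (simp add: Y_def Z_def algebra_simps)
  then have WY: "symmetric_pair Y W" using symmetric_pair_sym[OF WY0] by simp
  have "symmetric_pair Z Y"
    unfolding Y_def p_def
    by (intro symmetric_pair_diff symmetric_pair_scaleR symmetric_pair_refl
        symmetric_pair_closest_point C ne)
  then have "symmetric_pair Y Z" by (rule symmetric_pair_sym)
  from symmetric_pair_diff[OF WY this] have "symmetric_pair Y S" by (simp add: Z_def)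
  then have "diagonal Y" by (rule diagonal_if_symmetric_pair[OF S])
  have "diagonal Z"
    unfolding diagonal_iff_sign_flip
  proof
    fix q
    let ?F = "sign_flip q" and ?G = "sign_flip q"
    have "?F ** Y ** ?G = Y" using \<open>diagonal Y\<close> by (simp add: diagonal_iff_sign_flip)
    then have "(1 + e) *\<^sub>R (?F ** Z ** ?G) - ?\<pi> (?F ** Z ** ?G) = (1 + e) *\<^sub>R Z - ?\<pi> Z"
      by (simp add: Y_def p_def matrix_mul_diff matrix_mul_scaleR orthogonal_sign_flip
          closest_point_equivariant[OF C(1,2) ne C(3)])
    then show "?F ** Z ** ?G = Z" by (rule relaxed_residual_inj[OF C(1,2) ne e])
  qed
  then have "diagonal W" using S by (auto simp: Z_def diagonal_def generic_diagonal_def)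
  moreover have "(norm (W - S - p))\<^sup>2 \<le> (norm (X - S - c0))\<^sup>2 + 4 * e * norm X * norm S"
  proof -
    have "(norm (X - S - ?\<pi> (X - S)))\<^sup>2 \<le> (norm (X - S - c0))\<^sup>2"
      using closest_point_le[OF C(1) c0, of "X - S"] by (simp add: dist_norm power_mono)
    moreover have "(norm (W - S - p))\<^sup>2 / 2 - e * (W \<bullet> S) \<le> (norm (X - S - ?\<pi> (X - S)))\<^sup>2 / 2 - e * (X \<bullet> S)"
      using min[OF orbit_self] by (simp add: f_def p_def Z_def)
    moreover have "e * (W \<bullet> S) \<le> e * (norm X * norm S)" "e * (- (X \<bullet> S)) \<le> e * (norm X * norm S)"
      using e norm_cauchy_schwarz[of W S] norm_cauchy_schwarz[of "-X" S] norm_orbit[OF W]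
      by (simp_all only: mult_le_cancel_left_pos) simp_all
    moreover have "4 * e * norm X * norm S = 4 * (e * (norm X * norm S))" by simp
    ultimately show ?thesis unfolding mult_minus_right by linarith
  qed
  ultimately show thesis using W p that by blast
qed

lemma finite_linear_root: "finite {t :: real. a + t * b = 0}" if "b \<noteq> 0"
proof -
  have "{t. a + t * b = 0} \<subseteq> {- a / b}" using that by (auto simp: field_simps)
  then show ?thesis by (rule finite_subset) simp
qed

text \<open>
  The entries of \<open>d\<close> are positive and distinct. So each coincidence
  \<open>s\<^sub>k + t d\<^sub>k = 0\<close> or \<open>s\<^sub>k + t d\<^sub>k = \<plusminus> (s\<^sub>l + t d\<^sub>l)\<close> with \<open>k \<noteq> l\<close> is a linear equation in \<open>t\<close> with nonzero slope.
\<close>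

lemma finite_not_generic_diagonal:
  fixes s :: "real^('q::{finite,linorder})"
  assumes q: "CARD('q) = min CARD('m) CARD('n)"
  defines "d \<equiv> (\<chi> k. real (pos k) + 1)"
  shows "finite {t. \<not> generic_diagonal (Diag (s + t *\<^sub>R d) :: real^('n::{finite,linorder})^('m::{finite,linorder}))}"
proof -
  define B where "B = (\<Union>k. {t. s $ k + t * d $ k = 0}) \<union>
    (\<Union>k. \<Union>l\<in>-{k}. {t. (s $ k - s $ l) + t * (d $ k - d $ l) = 0}
       \<union> {t. (s $ k + s $ l) + t * (d $ k + d $ l) = 0})"
  have "d $ k > 0" for k by (simp add: d_def add_nonneg_pos)
  then have d: "d $ k \<noteq> 0" "d $ k + d $ l \<noteq> 0" for k l
    using add_pos_pos[of "d $ k" "d $ l"] by (simp_all add: less_imp_neq[symmetric])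
  have d': "d $ k - d $ l \<noteq> 0" if "k \<noteq> l" for k l
    using that by (simp add: d_def)
  have "finite B"
    unfolding B_def
    by (intro finite_UnI finite_UN_I finite finite_linear_root d d') auto
  moreover have "generic_diagonal (Diag (s + t *\<^sub>R d) :: real^('n::{finite,linorder})^('m::{finite,linorder}))" if "t \<notin> B" for t
    unfolding generic_diagonal_def
  proof (intro conjI allI impI diagonal_Diag)
    fix i :: 'm and j :: 'n assume "pos i = pos j"
    then obtain k :: 'q where k: "pos i = pos k" "pos j = pos k" by (rule diagonal_position[OF q])
    have "s $ k + t * d $ k \<noteq> 0" using that by (simp add: B_def)
    then show "Diag (s + t *\<^sub>R d) $ i $ j \<noteq> 0" by (simp add: Diag_entry[OF k])
    fix i' :: 'm and j' :: 'n assume "pos i' = pos j'"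
    then obtain l :: 'q where l: "pos i' = pos l" "pos j' = pos l" by (rule diagonal_position[OF q])
    assume "i \<noteq> i'"
    then have "k \<noteq> l" using k l by (metis pos_eq_iff)
    then have "(s $ k - s $ l) + t * (d $ k - d $ l) \<noteq> 0" "(s $ k + s $ l) + t * (d $ k + d $ l) \<noteq> 0"
      using that unfolding B_def by simp_all
    then show "(Diag (s + t *\<^sub>R d) $ i $ j)\<^sup>2 \<noteq> (Diag (s + t *\<^sub>R d) $ i' $ j')\<^sup>2"
      by (auto simp: Diag_entry[OF k] Diag_entry[OF l] power2_eq_iff algebra_simps)
  qed
  then have "{t. \<not> generic_diagonal (Diag (s + t *\<^sub>R d) :: real^('n::{finite,linorder})^('m::{finite,linorder}))} \<subseteq> B"
    by blast
  ultimately show ?thesis by (rule finite_subset[rotated])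
qed

text \<open>
  For \<open>C\<close> the convex hull of the orbit of \<open>X - Diag s\<close> this is in substance the Lidskii--Mirsky theorem:
  the difference of two suitably ordered vectors of singular values is weakly majorized by the singular values of
  the difference. A perturbation of size \<open>t\<close> makes \<open>Diag s\<close> generic, and the same \<open>t\<close> serves as
  the penalty \<open>e\<close> above, so that the distance to \<open>C\<close> tends to zero with \<open>t\<close>. A limit point in the compact orbit
  does the job for \<open>s\<close> itself.
\<close>

lemma diagonal_orbit_point:
  fixes C :: "(real^('n::{finite,linorder})^('m::{finite,linorder})) set"
    and s :: "real^('q::{finite,linorder})"
  assumes q: "CARD('q) = min CARD('m) CARD('n)"
    and C: "closed C" "convex C" "orbit_closed C" and X: "X - Diag s \<in> C"
  obtains x :: "real^('q::{finite,linorder})" where "Diag x \<in> orbit X" "Diag (x - s) \<in> C"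
proof -
  define d :: "real^('q::{finite,linorder})" where "d = (\<chi> k. real (pos k) + 1)"
  let ?S = "\<lambda>t. Diag (s + t *\<^sub>R d) :: real^('n::{finite,linorder})^('m::{finite,linorder})"
  have "\<exists>t. 0 < t \<and> t < 1 / real (Suc k) \<and> generic_diagonal (?S t)" for k
  proof -
    have "infinite {0<..<1 / real (Suc k)}" by (rule infinite_Ioo) simp
    then have "infinite ({0<..<1 / real (Suc k)} - {t. \<not> generic_diagonal (?S t)})"
      using finite_not_generic_diagonal[OF q, of s] unfolding d_def by (rule Diff_infinite_finite[rotated])
    then obtain t where "t \<in> {0<..<1 / real (Suc k)} - {t. \<not> generic_diagonal (?S t)}"
      using infinite_imp_nonempty by blast
    then show ?thesis by auto
  qed
  then obtain t where t: "\<And>k. 0 < t k" "\<And>k. t k < 1 / real (Suc k)" "\<And>k. generic_diagonal (?S (t k))"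
    by metis
  have t0: "t \<longlonglongrightarrow> 0"
  proof (rule tendsto_sandwich[OF _ _ tendsto_const LIMSEQ_inverse_real_of_nat])
    show "\<forall>\<^sub>F k in sequentially. 0 \<le> t k"
      using less_imp_le[OF t(1)] by (rule always_eventually[OF allI])
    show "\<forall>\<^sub>F k in sequentially. t k \<le> inverse (real (Suc k))"
      using less_imp_le[OF t(2)] unfolding inverse_eq_divide by (rule always_eventually[OF allI])
  qed
  let ?b = "\<lambda>k. (norm (X - ?S (t k) - (X - Diag s)))\<^sup>2 + 4 * t k * norm X * norm (?S (t k))"
  have "\<exists>W c. W \<in> orbit X \<and> diagonal W \<and> c \<in> C \<and> (norm (W - ?S (t k) - c))\<^sup>2 \<le> ?b k" for k
    by (rule diagonal_orbit_point_near[OF C X t(3,1)[of k], of X]) blast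
  then obtain W c where W: "\<And>k. W k \<in> orbit X" "\<And>k. diagonal (W k)" and c: "\<And>k. c k \<in> C"
    and b: "\<And>k. (norm (W k - ?S (t k) - c k))\<^sup>2 \<le> ?b k"
    by metis
  have S_lim: "(\<lambda>k. ?S (t k)) \<longlonglongrightarrow> Diag s"
  proof -
    have "(\<lambda>k. Diag s + t k *\<^sub>R Diag d) \<longlonglongrightarrow> (Diag s + 0 *\<^sub>R Diag d :: real^('n::{finite,linorder})^('m::{finite,linorder}))"
      by (intro tendsto_intros t0)
    then show ?thesis by (simp add: Diag_add Diag_scaleR)
  qed
  have "?b \<longlonglongrightarrow> (norm (X - Diag s - (X - Diag s)))\<^sup>2 + 4 * 0 * norm X * norm (Diag s :: real^('n::{finite,linorder})^('m::{finite,linorder}))"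
    by (intro tendsto_intros t0 S_lim)
  then have b0: "?b \<longlonglongrightarrow> 0" by simp
  have "(\<lambda>k. (norm (W k - ?S (t k) - c k))\<^sup>2) \<longlonglongrightarrow> 0"
  proof (rule tendsto_sandwich[OF _ _ tendsto_const b0])
    show "\<forall>\<^sub>F k in sequentially. 0 \<le> (norm (W k - ?S (t k) - c k))\<^sup>2" by simp
    show "\<forall>\<^sub>F k in sequentially. (norm (W k - ?S (t k) - c k))\<^sup>2 \<le> ?b k"
      using b by (rule always_eventually[OF allI])
  qed
  from tendsto_real_sqrt[OF this] have r0: "(\<lambda>k. W k - ?S (t k) - c k) \<longlonglongrightarrow> 0"
    by (simp add: tendsto_norm_zero_iff)
  obtain L r where L: "L \<in> orbit X" and r: "strict_mono r" "(W \<circ> r) \<longlonglongrightarrow> L"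
    using compact_orbit[of X, unfolded compact_def, rule_format, of W, OF W(1)] by blast
  have "diagonal L"
    unfolding diagonal_def
  proof (intro allI impI)
    fix i :: 'm and j :: 'n assume "pos i \<noteq> pos j"
    then have "(W \<circ> r) k $ i $ j = 0" for k
      using W(2)[of "r k", unfolded diagonal_def, rule_format] unfolding o_def by blast
    moreover have "(\<lambda>k. (W \<circ> r) k $ i $ j) \<longlonglongrightarrow> L $ i $ j" by (intro tendsto_vec_nth r)
    ultimately show "L $ i $ j = 0" by (simp only: LIMSEQ_const_iff)
  qed
  then obtain x :: "real^('q::{finite,linorder})" where x: "L = Diag x" by (rule diagonal_eq_Diag[OF q])
  have "(\<lambda>k. (W \<circ> r) k - ((\<lambda>k. ?S (t k)) \<circ> r) k - ((\<lambda>k. W k - ?S (t k) - c k) \<circ> r) k) \<longlonglongrightarrow> L - Diag s - 0"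
    by (intro tendsto_diff r LIMSEQ_subseq_LIMSEQ[OF S_lim r(1)] LIMSEQ_subseq_LIMSEQ[OF r0 r(1)])
  then have "(\<lambda>k. c (r k)) \<longlonglongrightarrow> L - Diag s" by (simp add: o_def)
  then have "L - Diag s \<in> C" by (rule closed_sequentially[OF C(1), rotated]) (rule c)
  then show thesis using that[of x] L unfolding x Diag_diff by blast
qed

section \<open>Sublevel sets and the reduction to diagonal matrices\<close>

lemma closed_sublevel_lsc:
  assumes "lsc F"
  shows "closed {x. F x \<le> c}"
  unfolding closed_limpt
proof (intro allI impI)
  fix x assume x: "x islimpt {x. F x \<le> c}"
  show "x \<in> {x. F x \<le> c}"
  proof (rule ccontr)
    assume "x \<notin> {x. F x \<le> c}"
    then have "c < Liminf (at x) F" using assms unfolding lsc_def by (metis less_le_trans mem_Collect_eq not_le)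
    then have "\<forall>\<^sub>F y in at x. c < F y" by (rule less_LiminfD)
    then have "\<forall>\<^sub>F y in at x. y \<notin> {x. F x \<le> c}" by (simp add: not_le)
    then show False using x by (simp add: islimpt_iff_eventually)
  qed
qed

lemma convex_sublevel:
  assumes "ereal_convex F"
  shows "convex {x. F x \<le> c}"
proof -
  have real: "convex {x. F x \<le> ereal r}" for r
  proof (rule convexI)
    fix x y and u v :: real
    assume "x \<in> {x. F x \<le> ereal r}" "y \<in> {x. F x \<le> ereal r}" and uv: "0 \<le> u" "0 \<le> v" "u + v = 1"
    then have "u *\<^sub>R (x, r) + v *\<^sub>R (y, r) \<in> {(x, r :: real). F x \<le> ereal r}"
      using assms unfolding ereal_convex_def by (intro convexD) auto
    moreover have "u * r + v * r = r" using uv by (simp flip: distrib_right)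
    ultimately show "u *\<^sub>R x + v *\<^sub>R y \<in> {x. F x \<le> ereal r}" by simp
  qed
  \<comment> \<open>The epigraph only sees real levels; the levels \<open>\<infinity>\<close> and \<open>-\<infinity>\<close> are reached by intersection.\<close>
  have "{x. F x \<le> c} = (\<Inter>r\<in>{r. c \<le> ereal r}. {x. F x \<le> ereal r})"
  proof (intro equalityI subsetI)
    fix x assume "x \<in> (\<Inter>r\<in>{r. c \<le> ereal r}. {x. F x \<le> ereal r})"
    then have "F x \<le> ereal r" if "c \<le> ereal r" for r using that by blast
    then show "x \<in> {x. F x \<le> c}" by (auto intro: ereal_le_real)
  qed (auto intro: order_trans)
  then show ?thesis by (auto intro!: convex_INT real)
qed

lemma argmin_iff: "x \<in> argmin F \<longleftrightarrow> (\<forall>y. F x \<le> F y)"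
  by (auto simp: argmin_def is_arg_min_def not_less)

lemma orthogonal_invariant_orbit: "orthogonal_invariant F \<Longrightarrow> W \<in> orbit X \<Longrightarrow> F W = F X"
  by (auto simp: orthogonal_invariant_def orbit_def)

lemma orthogonal_invariant_epi_scale: "orthogonal_invariant F \<Longrightarrow> orthogonal_invariant (g \<star> F)"
  by (simp add: orthogonal_invariant_def epi_scale_def flip: matrix_mul_scaleR)

text \<open>
  The sublevel set of \<open>g \<star> F\<close> at the value attained by \<open>X - Diag s\<close> is closed, convex and a union of orbits.
\<close>

lemma diagonal_reduction:
  fixes F :: "real^('n::{finite,linorder})^('m::{finite,linorder}) \<Rightarrow> ereal"
    and s :: "real^('q::{finite,linorder})"
  assumes q: "CARD('q) = min CARD('m) CARD('n)"
    and F: "orthogonal_invariant F" "ereal_convex F" "lsc F" and g: "g > 0"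
  obtains x :: "real^('q::{finite,linorder})" where "Diag x \<in> orbit X" "(g \<star> F) (Diag (x - s)) \<le> (g \<star> F) (X - Diag s)"
proof -
  define h where "h = (\<lambda>Z :: real^('n::{finite,linorder})^('m::{finite,linorder}). inverse g *\<^sub>R Z)"
  define C where "C = h -` {Z. F Z \<le> F (h (X - Diag s))}"
  have h: "linear h" unfolding h_def by (rule linear_scaleR)
  have "closed C" unfolding C_def
    by (intro closed_vimage closed_sublevel_lsc F) (simp add: h_def continuous_intros)
  moreover have "convex C" unfolding C_def
    by (intro convex_linear_vimage h convex_sublevel F)
  moreover have "orbit_closed C"
    using F(1) by (auto simp: orbit_closed_def orbit_def C_def h_def orthogonal_invariant_def simp flip: matrix_mul_scaleR)
  moreover have "X - Diag s \<in> C" by (simp add: C_def)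
  ultimately obtain x :: "real^('q::{finite,linorder})"
    where x: "Diag x \<in> orbit X" "Diag (x - s) \<in> C"
    by (rule diagonal_orbit_point[OF q])
  from x(2) g have "(g \<star> F) (Diag (x - s)) \<le> (g \<star> F) (X - Diag s)"
    by (simp add: C_def h_def epi_scale_def ereal_mult_left_mono)
  with x(1) show thesis by (rule that)
qed

theorem theorem3p5:
  fixes G \<Phi> :: "real^('n::{finite,linorder})^('m::{finite,linorder}) \<Rightarrow> ereal"
    and \<gamma> :: real
    and Y :: "real^('n::{finite,linorder})^('m::{finite,linorder})"
    and U :: "real^('m::{finite,linorder})^('m::{finite,linorder})"
    and V :: "real^('n::{finite,linorder})^('n::{finite,linorder})"
    and xstar :: "real^('q::{finite,linorder})"
  assumes "CARD('q) = min CARD('m) CARD('n)"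
    and "orthogonal_invariant G"
    and "orthogonal_invariant \<Phi>"
    and "ereal_convex \<Phi>"
    and "lsc \<Phi>"
    and "\<gamma> > 0"
    and "orthogonal_matrix U"
    and "orthogonal_matrix V"
    and "Y = U ** Diag (sing_vals Y :: real^('q::{finite,linorder})) ** transpose V"
    and "xstar \<in> argmin (\<lambda>x :: real^('q::{finite,linorder}). G (Diag x) + (\<gamma> \<star> \<Phi>) (Diag (x - sing_vals Y)))"
  shows "U ** Diag xstar ** transpose V \<in> argmin (\<lambda>X. G X + (\<gamma> \<star> \<Phi>) (X - Y))"
  unfolding argmin_iff
proof
  fix X
  define s :: "real^('q::{finite,linorder})" where "s = sing_vals Y"
  define X' where "X' = transpose U ** X ** V"
  have Vt: "orthogonal_matrix (transpose V)" and Ut: "orthogonal_matrix (transpose U)"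
    using assms(7,8) by simp_all
  have inv: "G (A ** Z ** B) = G Z" "(\<gamma> \<star> \<Phi>) (A ** Z ** B) = (\<gamma> \<star> \<Phi>) Z"
    if "orthogonal_matrix A" "orthogonal_matrix B" for A B Z
    using that assms(2) orthogonal_invariant_epi_scale[OF assms(3), of \<gamma>]
    unfolding orthogonal_invariant_def by blast+
  have Y: "Y = U ** Diag s ** transpose V" using assms(9) by (simp add: s_def)
  have "transpose U ** Y ** V = transpose U ** (U ** (Diag s ** transpose V ** V))"
    by (simp only: Y matrix_mul_assoc)
  also have "\<dots> = Diag s" using assms(7,8) by (simp add: orthogonal_matrix_cancel)
  finally have Y': "X' - Diag s = transpose U ** (X - Y) ** V"
    by (simp add: X'_def matrix_mul_diff)
  obtain x :: "real^('q::{finite,linorder})" where x: "Diag x \<in> orbit X'"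
    "(\<gamma> \<star> \<Phi>) (Diag (x - s)) \<le> (\<gamma> \<star> \<Phi>) (X' - Diag s)"
    by (rule diagonal_reduction[OF assms(1,3-6)])
  have "G (U ** Diag xstar ** transpose V) + (\<gamma> \<star> \<Phi>) (U ** Diag xstar ** transpose V - Y)
      = G (Diag xstar) + (\<gamma> \<star> \<Phi>) (Diag (xstar - s))"
    unfolding Y Diag_diff matrix_mul_diff[symmetric] using inv[OF assms(7) Vt] by simp
  also have "\<dots> \<le> G (Diag x) + (\<gamma> \<star> \<Phi>) (Diag (x - s))"
    using assms(10) unfolding argmin_iff s_def by blast
  also have "\<dots> \<le> G X' + (\<gamma> \<star> \<Phi>) (X' - Diag s)"
    using x(2) orthogonal_invariant_orbit[OF assms(2) x(1)] by (simp add: add_left_mono)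
  also have "\<dots> = G X + (\<gamma> \<star> \<Phi>) (X - Y)"
    unfolding Y' using inv[OF Ut assms(8)] by (simp add: X'_def)
  finally show "G (U ** Diag xstar ** transpose V) + (\<gamma> \<star> \<Phi>) (U ** Diag xstar ** transpose V - Y)
      \<le> G X + (\<gamma> \<star> \<Phi>) (X - Y)" .
qed

end
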